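(* Let $q$ be an odd prime power, let $E\subset\mathbb{F}_q^2$ be nonempty, and $n:=|E|$. For $t\in\mathbb{F}_q$ let $\nu(t):=|\{(\mathbf{x},\mathbf{y})\in E^2:\|\mathbf{x}-\mathbf{y}\|_P=t\}|$. Then \[ \sum_{t\in\mathbb{F}_q}\nu(t)^2\le\frac{n^4}{q}+q\,\mathcal{E}_{\mathrm{fib}}(E), \] and consequently \[ |\Delta_P(E)|\ge\frac{n^4}{\frac{n^4}{q}+q\,\mathcal{E}_{\mathrm{fib}}(E)}=\frac{q}{1+\frac{q^2\mathcal{E}_{\mathrm{fib}}(E)}{n^4}}. \]
   Context: For $\mathbf{x}=(x_1,x_2),\mathbf{y}=(y_1,y_2)\in\mathbb{F}_q^2$, the parabolic distance is $\|\mathbf{x}-\mathbf{y}\|_P:=(x_2-y_2)+(x_1-y_1)^2$, and $\Delta_P(E):=\{\|\mathbf{x}-\mathbf{y}\|_P:\mathbf{x},\mathbf{y}\in E\}$. For finite $P,Q\subset\mathbb{F}_q$, the additive energy is $E_+(P,Q):=|\{(x,x',y,y')\in P^2\times Q^2: x+y=x'+y'\}|$. For $u\in\mathbb{F}_q$, the vertical fiber is $E_u:=\{y\in\mathbb{F}_q:(u,y)\in E\}$, and the fiber alignment energy is $\mathcal{E}_{\mathrm{fib}}(E):=\sum_{u,u'\in\mathbb{F}_q}E_+(E_u,E_{u'})$. *)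

theory Defs
  imports Complex_Main "HOL-Library.Cardinality"
begin

text \<open>
  The field \<open>F\<^sub>q\<close> is an arbitrary type \<open>'a\<close> of sort \<open>{field, finite}\<close>, with \<open>q = CARD('a)\<close>;
  the cardinality of such a type is automatically a prime power, and every prime power occurs.
  Points of the plane are pairs.
\<close>

definition parabolic_dist :: "'a::field \<times> 'a \<Rightarrow> 'a \<times> 'a \<Rightarrow> 'a" where
  "parabolic_dist x y = (snd x - snd y) + (fst x - fst y)\<^sup>2"

definition parabolic_dist_set :: "('a::field \<times> 'a) set \<Rightarrow> 'a set" where
  "parabolic_dist_set E = {parabolic_dist x y | x y. x \<in> E \<and> y \<in> E}"

definition parabolic_count :: "('a::field \<times> 'a) set \<Rightarrow> 'a \<Rightarrow> nat" where
  "parabolic_count E t = card {(x, y). x \<in> E \<and> y \<in> E \<and> parabolic_dist x y = t}"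

definition additive_energy :: "'a::field set \<Rightarrow> 'a set \<Rightarrow> nat" where
  "additive_energy P Q =
     card {(x, x', y, y'). x \<in> P \<and> x' \<in> P \<and> y \<in> Q \<and> y' \<in> Q \<and> x + y = x' + y'}"

definition vertical_fiber :: "('a \<times> 'a) set \<Rightarrow> 'a \<Rightarrow> 'a set" where
  "vertical_fiber E u = {y. (u, y) \<in> E}"

definition fiber_energy :: "('a::{field, finite} \<times> 'a) set \<Rightarrow> nat" where
  "fiber_energy E =
     (\<Sum>u\<in>UNIV. \<Sum>u'\<in>UNIV. additive_energy (vertical_fiber E u) (vertical_fiber E u'))"

end

theory Submission
  imports Defs "HOL-Analysis.Convex" "HOL-Number_Theory.Residues"
begin

text \<open>
  Fix a nontrivial additive character \<open>\<chi>\<close> and put \<open>F\<^sub>s(u) = \<Sum>\<^bsub>y\<in>E\<^sub>u\<^esub> \<chi>(s y)\<close>. The Fourier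
  coefficient of \<open>\<nu>\<close> at \<open>s\<close> is \<open>\<Sum>\<^bsub>u,u'\<^esub> \<chi>(s(u - u')\<^sup>2) F\<^sub>s(u) cnj (F\<^sub>s(u'))\<close>. Expanding the
  square, the kernel is, up to unimodular factors in \<open>u\<close> and in \<open>u'\<close>, the Fourier matrix
  \<open>\<chi>(-2 s u u')\<close>, of operator norm \<open>\<surd>q\<close> when \<open>2 s \<noteq> 0\<close>. So for \<open>s \<noteq> 0\<close> the squared
  coefficient is at most \<open>q (\<Sum>\<^bsub>u\<^esub> \<bar>F\<^sub>s(u)\<bar>\<^sup>2)\<^sup>2\<close>, and by Parseval the sum of
  \<open>(\<Sum>\<^bsub>u\<^esub> \<bar>F\<^sub>s(u)\<bar>\<^sup>2)\<^sup>2\<close> over all \<open>s\<close> is \<open>q\<close> times the fiber energy. The frequency \<open>s = 0\<close>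
  contributes the main term, and the bound on the distance set is Cauchy--Schwarz.
\<close>

section \<open>Additive characters\<close>

locale additive_character =
  fixes \<chi> :: "'a::{field, finite} \<Rightarrow> complex"
  assumes add: "\<chi> (x + y) = \<chi> x * \<chi> y"
    and norm_eq_1 [simp]: "norm (\<chi> x) = 1"
    and nontrivial: "\<exists>x. \<chi> x \<noteq> 1"

text \<open>
  Modulo a maximal proper subgroup \<open>H\<close> the group is generated by any \<open>g \<notin> H\<close>, so a character
  is obtained by sending \<open>g\<close> to a primitive root of unity of order \<open>m\<close>, the order of \<open>g\<close>
  modulo \<open>H\<close>.
\<close>

lemma ex_additive_character: "\<exists>\<chi> :: 'a::{field, finite} \<Rightarrow> complex. additive_character \<chi>"
proof -
  define subgp :: "'a set \<Rightarrow> bool"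
    where "subgp H \<longleftrightarrow> 0 \<in> H \<and> (\<forall>x\<in>H. \<forall>y\<in>H. x - y \<in> H)" for H
  have subgp_diff: "x - y \<in> H" if "subgp H" "x \<in> H" "y \<in> H" for x y H
    using that by (auto simp: subgp_def)
  have subgp_add: "x + y \<in> H" if "subgp H" "x \<in> H" "y \<in> H" for x y H
    using that subgp_diff[of H x "0 - y"] subgp_diff[of H 0 y] by (auto simp: subgp_def)
  have "(1::'a) \<notin> {0}" by simp
  then have "subgp {0} \<and> {0} \<noteq> (UNIV :: 'a set)"
    unfolding subgp_def by (metis UNIV_I diff_zero singletonD singletonI)
  then have "{H. subgp H \<and> H \<noteq> UNIV} \<noteq> {}" by blast
  from finite_has_maximal[OF _ this] obtain H where H: "subgp H" "H \<noteq> UNIV"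
    and H_max: "\<And>K. subgp K \<Longrightarrow> K \<noteq> UNIV \<Longrightarrow> H \<subseteq> K \<Longrightarrow> H = K"
    by auto
  obtain g where g: "g \<notin> H" using H(2) by blast
  define K where "K = {h + of_int k * g | h k. h \<in> H}"
  have KI: "h + of_int k * g \<in> K" if "h \<in> H" for h k
    using that unfolding K_def by blast
  have "0 \<in> H" using H(1) by (simp add: subgp_def)
  have "subgp K"
    unfolding subgp_def
  proof (intro conjI ballI)
    show "0 \<in> K" using KI[OF \<open>0 \<in> H\<close>, of 0] by simp
    fix x y assume "x \<in> K" "y \<in> K"
    then obtain h k h' k' where "x = h + of_int k * g" "y = h' + of_int k' * g" "h \<in> H" "h' \<in> H"
      by (auto simp: K_def)
    then have "x - y = (h - h') + of_int (k - k') * g" "h - h' \<in> H"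
      using subgp_diff[OF H(1)] by (auto simp: algebra_simps)
    then show "x - y \<in> K" using KI[of "h - h'" "k - k'"] by simp
  qed
  moreover have "H \<subset> K"
  proof
    show "H \<subseteq> K" using KI[of _ 0] by auto
    have "g \<in> K" using KI[OF \<open>0 \<in> H\<close>, of 1] by simp
    with g show "H \<noteq> K" by blast
  qed
  ultimately have K: "K = UNIV"
    using H_max[of K] by blast
  have mult: "of_int k * x \<in> H" if "x \<in> H" for x k
  proof (induction k rule: int_induct[where k = 0])
    case base then show ?case using \<open>0 \<in> H\<close> by simp
  next
    case (step1 i)
    then show ?case using subgp_add[OF H(1) _ that] by (simp add: distrib_right)
  next
    case (step2 i)
    then show ?case using subgp_diff[OF H(1) _ that] by (simp add: left_diff_distrib)
  qed
  \<comment> \<open>The characteristic annihilates \<open>g\<close>, so some positive multiple of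
    \<open>g\<close> lies in \<open>H\<close> and the \<open>LEAST\<close> below is
    meaningful.\<close>
  have "CHAR('a) > 0" by (simp add: finite_imp_CHAR_pos)
  moreover have "of_nat CHAR('a) * g \<in> H" using \<open>0 \<in> H\<close> by simp
  ultimately have ex: "\<exists>m>0. of_nat m * g \<in> H" by blast
  define m where "m = (LEAST m. m > 0 \<and> of_nat m * g \<in> H)"
  have m: "m > 0" "of_nat m * g \<in> H"
    using LeastI_ex[OF ex] by (auto simp: m_def)
  have m_least: "m \<le> l" if "l > 0" "of_nat l * g \<in> H" for l
    unfolding m_def by (rule Least_le) (use that in simp)
  \<comment> \<open>Division with remainder: a nonzero remainder of \<open>k\<close> modulo
    \<open>m\<close> would be a smaller positive multiplier taking \<open>g\<close> into
    \<open>H\<close>.\<close>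
  have m_dvd: "int m dvd k" if k: "of_int k * g \<in> H" for k
  proof (rule ccontr)
    assume "\<not> int m dvd k"
    define r where "r = nat (k mod int m)"
    have r: "int r = k mod int m" using m(1) by (simp add: r_def)
    have "r > 0" using \<open>\<not> int m dvd k\<close> r by (auto simp: dvd_eq_mod_eq_0 intro!: Nat.gr0I)
    have "int r < int m" unfolding r using m(1) by simp
    then have "r < m" by simp
    have "of_nat r * g = (of_int (int r) * g :: 'a)" by simp
    also have "int r = k - (k div int m) * int m" using r by (simp add: minus_div_mult_eq_mod)
    also have "of_int \<dots> * g = of_int k * g - of_int (k div int m) * (of_nat m * g)"
      by (simp add: algebra_simps)
    finally have "of_nat r * g \<in> H" using subgp_diff[OF H(1) k mult[OF m(2)]] by simp
    with m_least[of r] \<open>r > 0\<close> \<open>r < m\<close> show False by simp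
  qed
  define e where "e k = cis (2 * pi * real_of_int k / real m)" for k
  have e_add: "e (k + l) = e k * e l" for k l
    by (simp add: e_def cis_mult add_divide_distrib algebra_simps)
  have e_eq_1: "e k = 1" if "int m dvd k" for k
  proof -
    from that obtain l where "k = int m * l" by blast
    then have "2 * pi * real_of_int k / real m = 2 * pi * real_of_int l"
      using m(1) by simp
    then show ?thesis by (simp add: e_def cis_multiple_2pi)
  qed
  have "\<forall>x. \<exists>k. x - of_int k * g \<in> H"
  proof
    fix x have "x \<in> K" using K by simp
    then obtain h k where "h \<in> H" "x = h + of_int k * g" by (auto simp: K_def)
    then show "\<exists>k. x - of_int k * g \<in> H" by (intro exI[of _ k]) simp
  qed
  \<comment> \<open>The choice of \<open>c x\<close> is arbitrary, but two choices differ by a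
    multiple of \<open>m\<close>, on which \<open>e\<close> is 1. Hence \<open>e (c x)\<close>
    depends on \<open>x\<close> alone, which is what makes it additive.\<close>
  then obtain c where c: "\<And>x. x - of_int (c x) * g \<in> H" by metis
  have e_c: "e (c x) = e k" if "x - of_int k * g \<in> H" for x k
  proof -
    have "of_int (c x - k) * g = (x - of_int k * g) - (x - of_int (c x) * g)"
      by (simp add: algebra_simps)
    then have "int m dvd c x - k" using subgp_diff[OF H(1) that c[of x]] by (intro m_dvd) simp
    from e_eq_1[OF this] e_add[of "c x - k" k] show ?thesis by simp
  qed
  have "additive_character (\<lambda>x. e (c x))"
  proof
    fix x y
    have "(x + y) - of_int (c x + c y) * g = (x - of_int (c x) * g) + (y - of_int (c y) * g)"
      by (simp add: algebra_simps)
    then have "(x + y) - of_int (c x + c y) * g \<in> H" using subgp_add[OF H(1) c c] by (simp only:)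
    from e_c[OF this] show "e (c (x + y)) = e (c x) * e (c y)" by (simp add: e_add)
  next
    show "norm (e (c x)) = 1" for x by (simp add: e_def)
  next
    have "e (c g) = e 1" by (rule e_c) (simp add: \<open>0 \<in> H\<close>)
    moreover have "e 1 \<noteq> 1"
    proof
      assume "e 1 = 1"
      then have "cos (2 * pi / real m) = 1"
        by (metis e_def cis.sel(1) mult.right_neutral of_int_1 one_complex.sel(1))
      then obtain i :: int where "2 * pi / real m = of_int i * 2 * pi"
        by (auto simp: cos_one_2pi_int)
      then have "1 = real_of_int i * real m" using m(1) by (simp add: field_simps)
      then have "of_int 1 = (of_int (i * int m) :: real)" by simp
      then have "1 = i * int m" by (simp only: of_int_eq_iff)
      then have "m = 1" using m(1) by (metis dvd_triv_right int_dvd_int_iff nat_dvd_1_iff_1 of_nat_1)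
      with m(2) g show False by simp
    qed
    ultimately show "\<exists>x. e (c x) \<noteq> 1" by metis
  qed
  then show ?thesis by blast
qed

section \<open>Orthogonality and Parseval identities\<close>

context additive_character
begin

lemma zero [simp]: "\<chi> 0 = 1"
proof -
  have "\<chi> 0 \<noteq> 0" using norm_eq_1[of 0] by (metis norm_zero zero_neq_one)
  then show ?thesis using add[of 0 0] by simp
qed

lemma cnj_eq: "cnj (\<chi> x) = \<chi> (- x)"
proof -
  have "\<chi> x * cnj (\<chi> x) = 1" by (simp add: complex_norm_square[symmetric])
  moreover have "\<chi> x * \<chi> (- x) = 1" using add[of x "- x"] by simp
  ultimately show ?thesis by (metis mult_left_cancel mult_zero_left zero_neq_one)
qed

text \<open>Translation by some \<open>a\<close> with \<open>\<chi> a \<noteq> 1\<close> permutes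
  the summands, yet multiplies the sum by \<open>\<chi> a\<close>.\<close>

lemma sum_eq_0: "(\<Sum>s\<in>UNIV. \<chi> s) = 0"
proof -
  obtain a where a: "\<chi> a \<noteq> 1" using nontrivial by blast
  have "(\<Sum>s\<in>UNIV. \<chi> s) = (\<Sum>s\<in>UNIV. \<chi> (a + s))"
    by (rule sum.reindex_bij_witness[of _ "\<lambda>s. a + s" "\<lambda>s. s - a"]) auto
  also have "\<dots> = \<chi> a * (\<Sum>s\<in>UNIV. \<chi> s)" by (simp add: add sum_distrib_left)
  finally show ?thesis using a by simp
qed

lemma orthogonality: "(\<Sum>s\<in>UNIV. \<chi> (s * x)) = (if x = 0 then of_nat CARD('a) else 0)"
proof (cases "x = 0")
  case False
  then have "(\<Sum>s\<in>UNIV. \<chi> (s * x)) = (\<Sum>s\<in>UNIV. \<chi> s)"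
    by (intro sum.reindex_bij_witness[of _ "\<lambda>s. s / x" "\<lambda>s. s * x"]) auto
  with False show ?thesis by (simp add: sum_eq_0)
qed simp

text \<open>Expanding the square gives phases \<open>s * (\<phi> a - \<phi> b)\<close>, and
  orthogonality keeps only the pairs on which \<open>\<phi>\<close> agrees. Since
  \<open>\<phi>\<close> may have collisions, this serves two purposes: an injective
  \<open>\<phi>\<close> gives the usual Parseval identity, and unit weights turn it into a collision
  count.\<close>

lemma parseval_weighted:
  fixes \<phi> :: "'b \<Rightarrow> 'a" and w :: "'b \<Rightarrow> complex"
  shows "complex_of_real (\<Sum>s\<in>UNIV. (norm (\<Sum>a\<in>A. w a * \<chi> (s * \<phi> a)))\<^sup>2) =
    of_nat CARD('a) * (\<Sum>a\<in>A. \<Sum>b\<in>A. if \<phi> a = \<phi> b then w a * cnj (w b) else 0)"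
proof -
  have "complex_of_real (\<Sum>s\<in>UNIV. (norm (\<Sum>a\<in>A. w a * \<chi> (s * \<phi> a)))\<^sup>2) =
    (\<Sum>s\<in>UNIV. (\<Sum>a\<in>A. w a * \<chi> (s * \<phi> a)) * cnj (\<Sum>b\<in>A. w b * \<chi> (s * \<phi> b)))"
    unfolding of_real_sum complex_norm_square ..
  also have "\<dots> = (\<Sum>s\<in>UNIV. \<Sum>a\<in>A. \<Sum>b\<in>A. w a * cnj (w b) * \<chi> (s * (\<phi> a - \<phi> b)))"
    unfolding cnj_sum sum_product
    by (intro sum.cong refl) (simp add: cnj_eq add algebra_simps flip: add_uminus_conv_diff)
  also have "\<dots> = (\<Sum>a\<in>A. \<Sum>s\<in>UNIV. \<Sum>b\<in>A. w a * cnj (w b) * \<chi> (s * (\<phi> a - \<phi> b)))"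
    by (rule sum.swap)
  also have "\<dots> = (\<Sum>a\<in>A. \<Sum>b\<in>A. \<Sum>s\<in>UNIV. w a * cnj (w b) * \<chi> (s * (\<phi> a - \<phi> b)))"
    by (intro sum.cong refl sum.swap)
  also have "\<dots> = (\<Sum>a\<in>A. \<Sum>b\<in>A. of_nat CARD('a) * (if \<phi> a = \<phi> b then w a * cnj (w b) else 0))"
    by (intro sum.cong refl) (simp add: sum_distrib_left[symmetric] orthogonality)
  finally show ?thesis by (simp add: sum_distrib_left)
qed

lemma parseval:
  assumes "c \<noteq> 0"
  shows "(\<Sum>s\<in>UNIV. (norm (\<Sum>a\<in>UNIV. w a * \<chi> (s * (c * a))))\<^sup>2) =
    real CARD('a) * (\<Sum>a\<in>UNIV. (norm (w a))\<^sup>2)"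
proof -
  have "complex_of_real (\<Sum>s\<in>UNIV. (norm (\<Sum>a\<in>UNIV. w a * \<chi> (s * (c * a))))\<^sup>2) =
      complex_of_real (real CARD('a) * (\<Sum>a\<in>UNIV. (norm (w a))\<^sup>2))"
    unfolding parseval_weighted using assms
    by (simp add: complex_norm_square del: of_real_power)
  then show ?thesis by (simp only: of_real_eq_iff)
qed

lemma parseval_count:
  assumes "finite A"
  shows "(\<Sum>s\<in>UNIV. (norm (\<Sum>a\<in>A. \<chi> (s * \<phi> a)))\<^sup>2) =
    real CARD('a) * real (card {(a, b) \<in> A \<times> A. \<phi> a = \<phi> b})"
proof -
  have "(\<Sum>a\<in>A. \<Sum>b\<in>A. if \<phi> a = \<phi> b then 1 else 0) =
      (\<Sum>p\<in>A \<times> A. if \<phi> (fst p) = \<phi> (snd p) then 1 else (0::complex))"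
    by (simp add: sum.cartesian_product split_def)
  also have "\<dots> = (\<Sum>p\<in>{(a, b) \<in> A \<times> A. \<phi> a = \<phi> b}. 1)"
    by (rule sum.mono_neutral_cong_right) (use assms in auto)
  finally have count: "(\<Sum>a\<in>A. \<Sum>b\<in>A. if \<phi> a = \<phi> b then 1 else 0) =
      complex_of_real (real (card {(a, b) \<in> A \<times> A. \<phi> a = \<phi> b}))"
    by simp
  have "complex_of_real (\<Sum>s\<in>UNIV. (norm (\<Sum>a\<in>A. \<chi> (s * \<phi> a)))\<^sup>2) =
      complex_of_real (real CARD('a) * real (card {(a, b) \<in> A \<times> A. \<phi> a = \<phi> b}))"
    using parseval_weighted[where A = A and w = "\<lambda>_. 1" and \<phi> = \<phi>] count
    by (simp cong: if_cong del: of_real_power of_real_sum)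
  then show ?thesis by (simp only: of_real_eq_iff)
qed

end

section \<open>The second moment of the parabolic distances\<close>

text \<open>Colliding pairs are sorted by their common value. This puts the second moment of
  \<open>parabolic_count\<close> into the form that \<open>parseval_count\<close> computes.\<close>

lemma sum_card_fibers_squared:
  fixes \<phi> :: "'b \<Rightarrow> 'c::finite"
  assumes "finite A"
  shows "(\<Sum>t\<in>UNIV. (card {a \<in> A. \<phi> a = t})\<^sup>2) = card {(a, b) \<in> A \<times> A. \<phi> a = \<phi> b}"
proof -
  have "{(a, b) \<in> A \<times> A. \<phi> a = \<phi> b} = (\<Union>t\<in>UNIV. {a \<in> A. \<phi> a = t} \<times> {a \<in> A. \<phi> a = t})"
    by auto
  also have "card \<dots> = (\<Sum>t\<in>UNIV. card ({a \<in> A. \<phi> a = t} \<times> {a \<in> A. \<phi> a = t}))"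
    by (rule card_UN_disjoint) (use assms in auto)
  finally show ?thesis by (simp add: card_cartesian_product power2_eq_square)
qed

text \<open>The characteristic divides the cardinality, so it cannot be 2. This keeps the frequency
  \<open>- 2 * s\<close> of the cross term nonzero.\<close>

lemma two_neq_zero_if_odd_card:
  assumes "odd CARD('a::{field, finite})"
  shows "(2::'a) \<noteq> 0"
proof
  assume "(2::'a) = 0"
  then have "of_nat 2 = (0::'a)" by simp
  then have "CHAR('a) dvd 2" by (simp only: of_nat_eq_0_iff_char_dvd)
  moreover have "CHAR('a) \<noteq> 1" by simp
  ultimately have "CHAR('a) = 2" by (metis prime_nat_iff two_is_prime_nat)
  with CHAR_dvd_CARD[where 'a = 'a] assms show False by simp
qed

lemma parabolic_count_eq:
  "parabolic_count E t = card {p \<in> E \<times> E. parabolic_dist (fst p) (snd p) = t}"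
  unfolding parabolic_count_def by (rule arg_cong[where f = card]) auto

lemma sum_over_fibers:
  fixes E :: "('a::{field, finite} \<times> 'a) set" and f :: "'a \<times> 'a \<Rightarrow> 'b::comm_monoid_add"
  shows "(\<Sum>x\<in>E. f x) = (\<Sum>u\<in>UNIV. \<Sum>y\<in>vertical_fiber E u. f (u, y))"
proof -
  have "E = Sigma UNIV (vertical_fiber E)" by (auto simp: vertical_fiber_def)
  then have "(\<Sum>x\<in>E. f x) = (\<Sum>x\<in>Sigma UNIV (vertical_fiber E). f x)" by simp
  also have "\<dots> = (\<Sum>u\<in>UNIV. \<Sum>y\<in>vertical_fiber E u. f (u, y))"
    by (simp add: sum.Sigma)
  finally show ?thesis .
qed

section \<open>Fourier transforms along the vertical fibers\<close>

context additive_character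
begin

definition fiber_transform :: "('a \<times> 'a) set \<Rightarrow> 'a \<Rightarrow> 'a \<Rightarrow> complex" where
  "fiber_transform E s u = (\<Sum>y\<in>vertical_fiber E u. \<chi> (s * y))"

definition fiber_mass :: "('a \<times> 'a) set \<Rightarrow> 'a \<Rightarrow> real" where
  "fiber_mass E s = (\<Sum>u\<in>UNIV. (norm (fiber_transform E s u))\<^sup>2)"

text \<open>A product of two fiber transforms is a character sum over \<open>y + y'\<close> on the
  product of the fibers; collisions of this sum map are exactly what additive energy counts.\<close>

lemma sum_fiber_mass_squared:
  "(\<Sum>s\<in>UNIV. (fiber_mass E s)\<^sup>2) = real CARD('a) * real (fiber_energy E)"
proof -
  have pair: "(\<Sum>s\<in>UNIV. (norm (fiber_transform E s u))\<^sup>2 * (norm (fiber_transform E s u'))\<^sup>2) =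
      real CARD('a) * real (additive_energy (vertical_fiber E u) (vertical_fiber E u'))" for u u'
  proof -
    let ?P = "vertical_fiber E u" and ?Q = "vertical_fiber E u'"
    let ?\<phi> = "\<lambda>p :: 'a \<times> 'a. fst p + snd p"
    have "fiber_transform E s u * fiber_transform E s u' = (\<Sum>p\<in>?P \<times> ?Q. \<chi> (s * ?\<phi> p))" for s
      by (simp add: fiber_transform_def sum_product sum.cartesian_product split_def add
          distrib_left)
    then have "(\<Sum>s\<in>UNIV. (norm (fiber_transform E s u))\<^sup>2 * (norm (fiber_transform E s u'))\<^sup>2) =
        (\<Sum>s\<in>UNIV. (norm (\<Sum>p\<in>?P \<times> ?Q. \<chi> (s * ?\<phi> p)))\<^sup>2)"
      by (simp flip: power_mult_distrib norm_mult)
    also have "\<dots> = real CARD('a) *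
        real (card {(p, p') \<in> (?P \<times> ?Q) \<times> (?P \<times> ?Q). ?\<phi> p = ?\<phi> p'})"
      by (rule parseval_count) simp
    also have "card {(p, p') \<in> (?P \<times> ?Q) \<times> (?P \<times> ?Q). ?\<phi> p = ?\<phi> p'} = additive_energy ?P ?Q"
      unfolding additive_energy_def
      by (rule bij_betw_same_card[of "\<lambda>((x, y), (x', y')). (x, x', y, y')"],
          rule bij_betw_byWitness[where f' = "\<lambda>(x, x', y, y'). ((x, y), (x', y'))"]) auto
    finally show ?thesis .
  qed
  have "(\<Sum>s\<in>UNIV. (fiber_mass E s)\<^sup>2) = (\<Sum>s\<in>UNIV. \<Sum>u\<in>UNIV. \<Sum>u'\<in>UNIV.
      (norm (fiber_transform E s u))\<^sup>2 * (norm (fiber_transform E s u'))\<^sup>2)"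
    by (simp add: fiber_mass_def power2_eq_square[of "sum _ _"] sum_product)
  also have "\<dots> = (\<Sum>u\<in>UNIV. \<Sum>s\<in>UNIV. \<Sum>u'\<in>UNIV.
      (norm (fiber_transform E s u))\<^sup>2 * (norm (fiber_transform E s u'))\<^sup>2)"
    by (rule sum.swap)
  also have "\<dots> = (\<Sum>u\<in>UNIV. \<Sum>u'\<in>UNIV. \<Sum>s\<in>UNIV.
      (norm (fiber_transform E s u))\<^sup>2 * (norm (fiber_transform E s u'))\<^sup>2)"
    by (intro sum.cong refl sum.swap)
  finally show ?thesis by (simp add: pair fiber_energy_def sum_distrib_left)
qed

lemma dist_transform_bound:
  assumes "(2::'a) \<noteq> 0" "s \<noteq> 0"
  shows "(norm (\<Sum>p\<in>E \<times> E. \<chi> (s * parabolic_dist (fst p) (snd p))))\<^sup>2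
    \<le> real CARD('a) * (fiber_mass E s)\<^sup>2"
proof -
  \<comment> \<open>The squares in \<open>(u - u')\<^sup>2 = u\<^sup>2 - 2 u u' + u'\<^sup>2\<close>
    are absorbed into \<open>a\<close> and \<open>b\<close>. Only the cross term couples the two
    points, so \<open>B\<close> is a Fourier transform of \<open>b\<close>; the conjugate in
    \<open>b\<close> reflects the minus sign of \<open>y'\<close>.\<close>
  define a where "a u = fiber_transform E s u * \<chi> (s * u\<^sup>2)" for u
  define b where "b u = cnj (fiber_transform E s u) * \<chi> (s * u\<^sup>2)" for u
  define B where "B u = (\<Sum>u'\<in>UNIV. b u' * \<chi> (u * ((- 2 * s) * u')))" for u
  have norm_a: "norm (a u) = norm (fiber_transform E s u)"
    and norm_b: "norm (b u) = norm (fiber_transform E s u)" for u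
    by (simp_all add: a_def b_def norm_mult)
  have kernel: "\<chi> (s * parabolic_dist (u, y) (u', y')) =
      \<chi> (s * y) * \<chi> (s * u\<^sup>2) * (\<chi> (- (s * y')) * \<chi> (s * u'\<^sup>2) * \<chi> (u * ((- 2 * s) * u')))"
    for u u' y y'
    unfolding add[symmetric]
    by (rule arg_cong[where f = \<chi>]) (simp add: parabolic_dist_def power2_eq_square algebra_simps)
  have "(\<Sum>p\<in>E \<times> E. \<chi> (s * parabolic_dist (fst p) (snd p))) =
      (\<Sum>x\<in>E. \<Sum>y\<in>E. \<chi> (s * parabolic_dist x y))"
    by (simp add: sum.cartesian_product split_def)
  also have "\<dots> = (\<Sum>u\<in>UNIV. \<Sum>y\<in>vertical_fiber E u. \<Sum>u'\<in>UNIV. \<Sum>y'\<in>vertical_fiber E u'.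
      \<chi> (s * parabolic_dist (u, y) (u', y')))"
    by (simp only: sum_over_fibers)
  also have "\<dots> = (\<Sum>u\<in>UNIV. a u * B u)"
  proof (rule sum.cong[OF refl])
    fix u
    have "(\<Sum>y\<in>vertical_fiber E u. \<Sum>u'\<in>UNIV. \<Sum>y'\<in>vertical_fiber E u'.
        \<chi> (s * parabolic_dist (u, y) (u', y'))) =
      (\<Sum>y\<in>vertical_fiber E u. \<chi> (s * y) * \<chi> (s * u\<^sup>2) * B u)"
      unfolding kernel B_def b_def fiber_transform_def
      by (simp only: sum_distrib_left sum_distrib_right cnj_sum cnj_eq)
    then show "(\<Sum>y\<in>vertical_fiber E u. \<Sum>u'\<in>UNIV. \<Sum>y'\<in>vertical_fiber E u'.
        \<chi> (s * parabolic_dist (u, y) (u', y'))) = a u * B u"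
      by (simp add: a_def fiber_transform_def sum_distrib_right)
  qed
  finally have "norm (\<Sum>p\<in>E \<times> E. \<chi> (s * parabolic_dist (fst p) (snd p))) \<le>
      (\<Sum>u\<in>UNIV. norm (a u) * norm (B u))"
    by (simp add: sum_norm_le norm_mult)
  then have "(norm (\<Sum>p\<in>E \<times> E. \<chi> (s * parabolic_dist (fst p) (snd p))))\<^sup>2 \<le>
      (\<Sum>u\<in>UNIV. norm (a u) * norm (B u))\<^sup>2"
    by (rule power_mono) simp
  also have "\<dots> \<le> (\<Sum>u\<in>UNIV. (norm (a u))\<^sup>2) * (\<Sum>u\<in>UNIV. (norm (B u))\<^sup>2)"
    by (rule Cauchy_Schwarz_ineq_sum)
  also have "(\<Sum>u\<in>UNIV. (norm (a u))\<^sup>2) = fiber_mass E s"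
    by (simp add: fiber_mass_def norm_a)
  \<comment> \<open>Here \<open>u\<close> plays the frequency variable of Parseval, with the nonzero
    scaling \<open>- 2 * s\<close>.\<close>
  also have "(\<Sum>u\<in>UNIV. (norm (B u))\<^sup>2) = real CARD('a) * fiber_mass E s"
    using parseval[of "- 2 * s" b] assms by (simp add: B_def fiber_mass_def norm_b)
  finally show ?thesis by (simp add: power2_eq_square algebra_simps)
qed

lemma second_moment_bound:
  fixes E :: "('a \<times> 'a) set"
  assumes "(2::'a) \<noteq> 0"
  shows "(\<Sum>t\<in>UNIV. (real (parabolic_count E t))\<^sup>2)
    \<le> real (card E) ^ 4 / real CARD('a) + real CARD('a) * real (fiber_energy E)"
proof -
  let ?q = "real CARD('a)"
  let ?d = "\<lambda>p :: ('a \<times> 'a) \<times> ('a \<times> 'a). parabolic_dist (fst p) (snd p)"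
  define N where "N s = (norm (\<Sum>p\<in>E \<times> E. \<chi> (s * ?d p)))\<^sup>2" for s
  \<comment> \<open>The factor \<open>?q\<close> is the one produced by Parseval; dividing by it at
    the end turns the zero frequency into the main term.\<close>
  have "?q * (\<Sum>t\<in>UNIV. (real (parabolic_count E t))\<^sup>2) =
      ?q * real (\<Sum>t\<in>UNIV. (card {p \<in> E \<times> E. ?d p = t})\<^sup>2)"
    by (simp add: parabolic_count_eq)
  also have "\<dots> = (\<Sum>s\<in>UNIV. N s)"
    unfolding N_def by (subst sum_card_fibers_squared) (simp_all add: parseval_count)
  also have "\<dots> = N 0 + (\<Sum>s\<in>UNIV - {0}. N s)"
    by (rule sum.remove) auto
  also have "N 0 = real (card E) ^ 4"
    by (simp add: N_def card_cartesian_product norm_mult power_mult_distrib flip: power_add)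
  also have "(\<Sum>s\<in>UNIV - {0}. N s) \<le> (\<Sum>s\<in>UNIV - {0}. ?q * (fiber_mass E s)\<^sup>2)"
    unfolding N_def by (intro sum_mono dist_transform_bound) (use assms in auto)
  \<comment> \<open>Restoring the nonnegative term at \<open>s = 0\<close> allows the fourth-moment
    identity over all frequencies.\<close>
  also have "\<dots> \<le> (\<Sum>s\<in>UNIV. ?q * (fiber_mass E s)\<^sup>2)"
    by (rule sum_mono2) auto
  also have "\<dots> = ?q * (?q * real (fiber_energy E))"
    by (simp add: sum_fiber_mass_squared flip: sum_distrib_left)
  finally show ?thesis by (simp add: field_simps)
qed

end

section \<open>From the second moment to the distance set\<close>

lemma card_pow4_le:
  fixes E :: "('a::{field, finite} \<times> 'a) set"
  shows "real (card E) ^ 4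
    \<le> real (card (parabolic_dist_set E)) * (\<Sum>t\<in>UNIV. (real (parabolic_count E t))\<^sup>2)"
proof -
  let ?D = "parabolic_dist_set E"
  let ?d = "\<lambda>p :: ('a \<times> 'a) \<times> ('a \<times> 'a). parabolic_dist (fst p) (snd p)"
  have "(\<Sum>t\<in>?D. \<Sum>p\<in>{p \<in> E \<times> E. ?d p = t}. 1) = (\<Sum>p\<in>E \<times> E. 1::real)"
    by (rule sum.group) (force simp: parabolic_dist_set_def)+
  then have "(\<Sum>t\<in>?D. real (parabolic_count E t)) = (real (card E))\<^sup>2"
    by (simp add: parabolic_count_eq card_cartesian_product power2_eq_square)
  then have "real (card E) ^ 4 = (\<Sum>t\<in>?D. real (parabolic_count E t))\<^sup>2"
    by (simp flip: power_mult)
  \<comment> \<open>Cauchy-Schwarz against the constant 1 on \<open>?D\<close>: the counts on this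
    set already account for every ordered pair of points.\<close>
  also have "\<dots> \<le> (\<Sum>t\<in>?D. (real (parabolic_count E t))\<^sup>2) * real (card ?D)"
    by (rule sum_squared_le_sum_of_squares)
  also have "\<dots> \<le> (\<Sum>t\<in>UNIV. (real (parabolic_count E t))\<^sup>2) * real (card ?D)"
    by (intro mult_right_mono sum_mono2) auto
  finally show ?thesis by (simp add: mult.commute)
qed

theorem theorem6p1:
  fixes E :: "('a::{field, finite} \<times> 'a) set"
    and q n :: real
  defines "q \<equiv> real CARD('a)"
    and "n \<equiv> real (card E)"
  assumes "odd CARD('a)"
    and "E \<noteq> {}"
  shows "(\<Sum>t\<in>UNIV. (real (parabolic_count E t))\<^sup>2) \<le> n ^ 4 / q + q * real (fiber_energy E)
    \<and> real (card (parabolic_dist_set E)) \<ge> n ^ 4 / (n ^ 4 / q + q * real (fiber_energy E))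
    \<and> n ^ 4 / (n ^ 4 / q + q * real (fiber_energy E))
        = q / (1 + q\<^sup>2 * real (fiber_energy E) / n ^ 4)"
proof -
  let ?S = "\<Sum>t\<in>UNIV. (real (parabolic_count E t))\<^sup>2"
  let ?M = "n ^ 4 / q + q * real (fiber_energy E)"
  have q: "q > 0" by (simp add: q_def)
  have n: "n > 0" using assms(4) by (simp add: n_def card_gt_0_iff)
  \<comment> \<open>Nonemptiness of \<open>E\<close> makes the denominator positive, so the division
    below is genuine.\<close>
  have M: "?M > 0" using q n by (simp add: add_pos_nonneg)
  obtain \<chi> :: "'a \<Rightarrow> complex" where "additive_character \<chi>"
    using ex_additive_character by blast
  then have moment: "?S \<le> ?M"
    unfolding q_def n_def
    using two_neq_zero_if_odd_card[OF assms(3)] by (rule additive_character.second_moment_bound)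
  have "n ^ 4 \<le> real (card (parabolic_dist_set E)) * ?S"
    unfolding n_def by (rule card_pow4_le)
  also have "\<dots> \<le> real (card (parabolic_dist_set E)) * ?M"
    using moment by (rule mult_left_mono) simp
  finally have "n ^ 4 / ?M \<le> real (card (parabolic_dist_set E))"
    using M by (simp add: pos_divide_le_eq)
  moreover have "n ^ 4 / ?M = q / (1 + q\<^sup>2 * real (fiber_energy E) / n ^ 4)"
  proof -
    have "1 + q\<^sup>2 * real (fiber_energy E) / n ^ 4 = q / n ^ 4 * ?M"
      using q n by (simp add: field_simps power2_eq_square)
    then show ?thesis using q n by simp
  qed
  ultimately show ?thesis using moment by blast
qed

end
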